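(* Let $(\mathcal M,X)$ be an irreducible concurrent system. Then, relatively to any Markov measure $\nu=(\nu_\alpha)_{\alpha\in X}$, the Markov chain of state-and-cliques stays within $\mathsf{DSC}^+$; that is, for every $\alpha\in X$, $\nu_\alpha$-almost surely, all the state-and-cliques $(\alpha_i,C_{i+1})$, $i\geqslant0$, are stable.
   Context: Trace monoids. Let $\Sigma$ be a finite set and $I\subseteq\Sigma\times\Sigma$ irreflexive and symmetric. The trace monoid $\mathcal M=\mathcal M(\Sigma,I)$ is presented by $\langle\Sigma\mid ab=ba\text{ for }(a,b)\in I\rangle$. Its elements are traces, $\varepsilon$ is the unit, and $x\leqslant y$ means $y=xz$ for some $z\in\mathcal M$. $\mathcal M$ is irreducible if the graph $(\Sigma,(\Sigma\times\Sigma)\setminus I)$ is connected. A clique is a trace $a_1\cdots a_k$ of letters with $(a_i,a_j)\in I$ for $i\neq j$; cliques are identified with subsets of $\Sigma$. For cliques write $c\to d$ if for every letter $b\in d$ there is a letter $a\in c$ with $(a,b)\notin I$. Every trace $x$ has a unique normal form $x=c_1\cdots c_n$ with non-empty cliques $c_i\to c_{i+1}$; put $C_i(x)=c_i$ for $i\leqslant n$ and $C_i(x)=\varepsilon$ for $i>n$. Infinite traces. An infinite trace is a sequence $\omega=(c_i)_{i\geqslant1}$ of non-empty cliques with $c_i\to c_{i+1}$ for all $i$; $C_i(\omega)=c_i$. The set $\partial\mathcal M$ of infinite traces carries its Borel $\sigma$-algebra. For $x\in\mathcal M$, $x\leqslant\omega$ means $x\leqslant C_1(\omega)\cdots C_n(\omega)$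 for some $n$, and ${\uparrow}x=\{\omega\in\partial\mathcal M:x\leqslant\omega\}$. Concurrent systems. A concurrent system is a pair $(\mathcal M,X)$, $X$ a finite set of states, with a right monoid action of $\mathcal M$ on $X\sqcup\{\bot\}$, where $\bot\cdot x=\bot$ for all $x$. Put $\mathcal M_\alpha=\{x:\alpha\cdot x\neq\bot\}$, $\mathcal M_{\alpha,\beta}=\{x:\alpha\cdot x=\beta\}$, and $\partial\mathcal M_\alpha=\{\omega\in\partial\mathcal M: x\in\mathcal M_\alpha\text{ for all }x\in\mathcal M\text{ with }x\leqslant\omega\}$. Non-trivial: $\alpha\cdot a\neq\bot$ for some $\alpha\in X$, $a\in\Sigma$. Transitive: $\mathcal M_{\alpha,\beta}\neq\emptyset$ for all $\alpha,\beta\in X$. Irreducible: (1) transitive and non-trivial; (2) $\mathcal M$ is irreducible; (3) for all $\alpha\in X$, $a\in\Sigma$ there is $u\in\mathcal M$ with $\alpha\cdot(ua)\neq\bot$. Markov measures. A Markov measure is a family $\nu=(\nu_\alpha)_{\alpha\in X}$ of probability measures on $\partial\mathcal M$ with $\nu_\alpha(\partial\mathcal M_\alpha)=1$, $x\in\mathcal M_\alpha\iff\nu_\alpha({\uparrow}x)>0$, and $\nu_\alpha({\uparrow}(xy))=\nu_\alpha({\uparrow}x)\,\nu_{\alpha\cdot x}({\uparrow}y)$ for all $\alpha,x,y$ (right-hand side $0$ if $\alpha\cdot x=\bot$). State-and-cliques. A state-and-clique is a pair $(\alpha,c)$ with $\alpha\in X$, $c$ a non-empty clique, $\alpha\cdot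 c\neq\bot$. Write $(\alpha,c)\to(\beta,d)$ if $\beta=\alpha\cdot c$ and $c\to d$; this defines the digraph $\mathsf{DSC}$. $(\alpha,c)$ is stable if there is $x\in\mathcal M_\alpha$ such that every $z\in\mathcal M_\alpha$ with $x\leqslant z$ satisfies $C_1(z)=c$. $\mathsf{DSC}^+$ is the sub-digraph of $\mathsf{DSC}$ induced on stable state-and-cliques. For an initial state $\alpha$ and $\omega\in\partial\mathcal M_\alpha$, the Markov chain of state-and-cliques is the process $(\alpha_i,C_{i+1})_{i\geqslant0}$ on $(\partial\mathcal M_\alpha,\nu_\alpha)$ with $C_{i+1}=C_{i+1}(\omega)$, $\alpha_0=\alpha$, $\alpha_{i+1}=\alpha_i\cdot C_{i+1}$. *)

theory Defs
  imports "HOL-Probability.Probability" "HOL-Algebra.Divisibility"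
begin

section \<open>Trace monoids\<close>

text \<open>The alphabet is the finite type \<^typ>\<open>'a\<close>; \<open>I\<close> is the independence relation. The following
  is the least monoid congruence on words that identifies \<open>ab\<close> and \<open>ba\<close> for \<open>(a, b) \<in> I\<close>.\<close>

inductive_set trace_cong :: "('a \<times> 'a) set \<Rightarrow> ('a list \<times> 'a list) set"
  for I :: "('a \<times> 'a) set" where
  refl: "(u, u) \<in> trace_cong I"
| sym: "(u, v) \<in> trace_cong I \<Longrightarrow> (v, u) \<in> trace_cong I"
| trans: "(u, v) \<in> trace_cong I \<Longrightarrow> (v, w) \<in> trace_cong I \<Longrightarrow> (u, w) \<in> trace_cong I"
| swap: "(a, b) \<in> I \<Longrightarrow> (u @ [a, b] @ v, u @ [b, a] @ v) \<in> trace_cong I"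

definition trace_of :: "('a \<times> 'a) set \<Rightarrow> 'a list \<Rightarrow> 'a list set" where
  "trace_of I w = trace_cong I `` {w}"

definition trace_monoid :: "('a \<times> 'a) set \<Rightarrow> 'a list set monoid" where
  "trace_monoid I =
    \<lparr>carrier = UNIV // trace_cong I,
     mult = (\<lambda>x y. \<Union>u\<in>x. \<Union>v\<in>y. trace_of I (u @ v)),
     one = trace_of I []\<rparr>"

lemma equiv_trace_cong: "equiv UNIV (trace_cong I)"
  by (intro equivI refl_onI symI transI) (simp_all add: trace_cong.refl, (fact trace_cong.sym trace_cong.trans)+)

lemma trace_cong_context:
  "(u, v) \<in> trace_cong I \<Longrightarrow> (s @ u @ t, s @ v @ t) \<in> trace_cong I"
proof (induction rule: trace_cong.induct)
  case (refl u)
  show ?case by (rule trace_cong.refl)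
next
  case (sym u v)
  from sym.IH show ?case by (rule trace_cong.sym)
next
  case (trans u v w)
  from trans.IH show ?case by (rule trace_cong.trans)
next
  case (swap a b u v)
  then show ?case
    using trace_cong.swap[of a b I "s @ u" "v @ t"] by simp
qed

lemma trace_cong_append:
  assumes "(u, u') \<in> trace_cong I" "(v, v') \<in> trace_cong I"
  shows "(u @ v, u' @ v') \<in> trace_cong I"
proof (rule trace_cong.trans)
  show "(u @ v, u' @ v) \<in> trace_cong I"
    using trace_cong_context[OF assms(1), of "[]" v] by simp
  show "(u' @ v, u' @ v') \<in> trace_cong I"
    using trace_cong_context[OF assms(2), of u' "[]"] by simp
qed

lemma trace_of_eq_iff: "trace_of I u = trace_of I v \<longleftrightarrow> (u, v) \<in> trace_cong I"
  unfolding trace_of_def using eq_equiv_class_iff[OF equiv_trace_cong] by blast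

lemma carrier_trace_monoid: "carrier (trace_monoid I) = range (trace_of I)"
  by (auto simp: trace_monoid_def quotient_def trace_of_def)

lemma one_trace_monoid: "\<one>\<^bsub>trace_monoid I\<^esub> = trace_of I []"
  by (simp add: trace_monoid_def)

lemma mult_trace_monoid:
  "trace_of I u \<otimes>\<^bsub>trace_monoid I\<^esub> trace_of I v = trace_of I (u @ v)"
proof -
  have *: "trace_of I (u' @ v') = trace_of I (u @ v)"
    if "u' \<in> trace_of I u" "v' \<in> trace_of I v" for u' v'
    unfolding trace_of_eq_iff
    by (rule trace_cong.sym, rule trace_cong_append) (use that in \<open>simp_all add: trace_of_def\<close>)
  have "u \<in> trace_of I u" "v \<in> trace_of I v"
    by (simp_all add: trace_of_def trace_cong.refl)
  then have "(\<Union>u'\<in>trace_of I u. \<Union>v'\<in>trace_of I v. trace_of I (u' @ v')) = trace_of I (u @ v)"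
    using * by blast
  then show ?thesis
    by (simp add: trace_monoid_def)
qed

lemma monoid_trace_monoid: "monoid (trace_monoid I)"
  by unfold_locales
    (auto simp: carrier_trace_monoid one_trace_monoid mult_trace_monoid)


section \<open>Cliques and normal forms\<close>

text \<open>Cliques are represented by their sets of letters.\<close>

definition clique :: "('a \<times> 'a) set \<Rightarrow> 'a set \<Rightarrow> bool" where
  "clique I c \<longleftrightarrow> finite c \<and> (\<forall>a\<in>c. \<forall>b\<in>c. a \<noteq> b \<longrightarrow> (a, b) \<in> I)"

text \<open>The trace corresponding to a clique; the choice of the enumeration is irrelevant,
  see \<open>clique_trace_eq\<close> below.\<close>

definition clique_trace :: "('a \<times> 'a) set \<Rightarrow> 'a set \<Rightarrow> 'a list set" where
  "clique_trace I c = trace_of I (SOME w. distinct w \<and> set w = c)"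

definition clique_step :: "('a \<times> 'a) set \<Rightarrow> 'a set \<Rightarrow> 'a set \<Rightarrow> bool" where
  "clique_step I c d \<longleftrightarrow> (\<forall>b\<in>d. \<exists>a\<in>c. (a, b) \<notin> I)"

definition clique_prod :: "('a \<times> 'a) set \<Rightarrow> 'a set list \<Rightarrow> 'a list set" where
  "clique_prod I cs = foldr (\<lambda>c y. clique_trace I c \<otimes>\<^bsub>trace_monoid I\<^esub> y) cs \<one>\<^bsub>trace_monoid I\<^esub>"

definition normal_form :: "('a \<times> 'a) set \<Rightarrow> 'a list set \<Rightarrow> 'a set list \<Rightarrow> bool" where
  "normal_form I x cs \<longleftrightarrow>
     (\<forall>c\<in>set cs. clique I c \<and> c \<noteq> {}) \<and>
     (\<forall>i. Suc i < length cs \<longrightarrow> clique_step I (cs ! i) (cs ! Suc i)) \<and>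
     x = clique_prod I cs"

text \<open>Indices are shifted by one: \<open>nf_clique I x i\<close> is $C_{i+1}(x)$. The normal form of a trace
  exists and is unique when \<open>I\<close> is irreflexive and symmetric.\<close>

definition nf_clique :: "('a \<times> 'a) set \<Rightarrow> 'a list set \<Rightarrow> nat \<Rightarrow> 'a set" where
  "nf_clique I x i =
     (let cs = (THE cs. normal_form I x cs) in if i < length cs then cs ! i else {})"

lemma trace_cong_move:
  "(\<And>b. b \<in> set u \<Longrightarrow> (a, b) \<in> I) \<Longrightarrow> (a # u @ v, u @ a # v) \<in> trace_cong I"
proof (induction u)
  case Nil
  show ?case by (simp add: trace_cong.refl)
next
  case (Cons b u)
  have "(a # b # u @ v, b # a # u @ v) \<in> trace_cong I"
    using trace_cong.swap[of a b I "[]" "u @ v"] Cons.prems by simp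
  moreover have "(b # a # u @ v, b # u @ a # v) \<in> trace_cong I"
    using trace_cong_context[OF Cons.IH, of "[b]" "[]"] Cons.prems by simp
  ultimately show ?case
    by (simp add: trace_cong.trans)
qed

lemma clique_words_cong:
  "clique I (set u) \<Longrightarrow> distinct u \<Longrightarrow> distinct v \<Longrightarrow> set u = set v \<Longrightarrow> (u, v) \<in> trace_cong I"
proof (induction u arbitrary: v)
  case Nil
  then show ?case by (simp add: trace_cong.refl)
next
  case (Cons a u)
  then obtain v1 v2 where v: "v = v1 @ a # v2"
    by (metis list.set_intros(1) split_list)
  have "(u, v1 @ v2) \<in> trace_cong I"
    using Cons.prems v by (intro Cons.IH) (auto simp: clique_def)
  then have "(a # u, a # v1 @ v2) \<in> trace_cong I"
    using trace_cong_context[of u "v1 @ v2" I "[a]" "[]"] by simp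
  moreover have "(a # v1 @ v2, v) \<in> trace_cong I"
    unfolding v using Cons.prems v by (intro trace_cong_move) (auto simp: clique_def)
  ultimately show ?case
    by (rule trace_cong.trans)
qed

lemma clique_trace_eq:
  assumes "clique I c" "distinct w" "set w = c"
  shows "clique_trace I c = trace_of I w"
proof -
  have "distinct (SOME w. distinct w \<and> set w = c) \<and> set (SOME w. distinct w \<and> set w = c) = c"
    by (rule someI) (use assms in blast)
  then show ?thesis
    unfolding clique_trace_def trace_of_eq_iff
    by (intro clique_words_cong) (use assms in auto)
qed


section \<open>Infinite traces\<close>

text \<open>An infinite trace is a function \<open>\<omega>\<close> with \<open>\<omega> i\<close> standing for $C_{i+1}(\omega)$.\<close>

definition inf_traces :: "('a \<times> 'a) set \<Rightarrow> (nat \<Rightarrow> 'a set) set" where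
  "inf_traces I =
     {\<omega>. \<forall>i. clique I (\<omega> i) \<and> \<omega> i \<noteq> {} \<and> clique_step I (\<omega> i) (\<omega> (Suc i))}"

definition inf_trace_topology :: "('a \<times> 'a) set \<Rightarrow> (nat \<Rightarrow> 'a set) topology" where
  "inf_trace_topology I =
     subtopology (product_topology (\<lambda>_. discrete_topology UNIV) UNIV) (inf_traces I)"

definition inf_trace_borel :: "('a \<times> 'a) set \<Rightarrow> (nat \<Rightarrow> 'a set) measure" where
  "inf_trace_borel I = sigma (inf_traces I) {U. openin (inf_trace_topology I) U}"

text \<open>In the trace monoid, \<open>x \<le> y\<close> is left divisibility, which is the relation \<^const>\<open>factor\<close>.\<close>

definition trace_below :: "('a \<times> 'a) set \<Rightarrow> 'a list set \<Rightarrow> (nat \<Rightarrow> 'a set) \<Rightarrow> bool" where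
  "trace_below I x \<omega> \<longleftrightarrow> (\<exists>n. x divides\<^bsub>trace_monoid I\<^esub> clique_prod I (map \<omega> [0..<n]))"

definition up_set :: "('a \<times> 'a) set \<Rightarrow> 'a list set \<Rightarrow> (nat \<Rightarrow> 'a set) set" where
  "up_set I x = {\<omega> \<in> inf_traces I. trace_below I x \<omega>}"


section \<open>Concurrent systems\<close>

text \<open>The states form the finite type \<^typ>\<open>'s\<close>; the sink is \<^const>\<open>None\<close>.\<close>

locale concurrent_system =
  fixes I :: "('a::finite \<times> 'a) set"
    and act :: "'s::finite option \<Rightarrow> 'a list set \<Rightarrow> 's option"
  assumes irrefl_indep: "irrefl I"
    and sym_indep: "sym I"
    and act_one: "act p \<one>\<^bsub>trace_monoid I\<^esub> = p"
    and act_mult: "\<lbrakk>x \<in> carrier (trace_monoid I); y \<in> carrier (trace_monoid I)\<rbrakk> \<Longrightarrow>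
      act p (x \<otimes>\<^bsub>trace_monoid I\<^esub> y) = act (act p x) y"
    and act_None: "x \<in> carrier (trace_monoid I) \<Longrightarrow> act None x = None"

definition enabled ::
  "('a \<times> 'a) set \<Rightarrow> ('s option \<Rightarrow> 'a list set \<Rightarrow> 's option) \<Rightarrow> 's \<Rightarrow> 'a list set set" where
  "enabled I act \<alpha> = {x \<in> carrier (trace_monoid I). act (Some \<alpha>) x \<noteq> None}"

definition inf_enabled ::
  "('a \<times> 'a) set \<Rightarrow> ('s option \<Rightarrow> 'a list set \<Rightarrow> 's option) \<Rightarrow> 's \<Rightarrow> (nat \<Rightarrow> 'a set) set" where
  "inf_enabled I act \<alpha> =
     {\<omega> \<in> inf_traces I. \<forall>x\<in>carrier (trace_monoid I). trace_below I x \<omega> \<longrightarrow> x \<in> enabled I act \<alpha>}"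

locale irreducible_concurrent_system = concurrent_system I act
  for I :: "('a::finite \<times> 'a) set"
    and act :: "'s::finite option \<Rightarrow> 'a list set \<Rightarrow> 's option" +
  assumes transitive: "\<exists>x\<in>carrier (trace_monoid I). act (Some \<alpha>) x = Some \<beta>"
    and non_trivial: "\<exists>\<alpha> a. trace_of I [a] \<in> enabled I act \<alpha>"
    and irreducible_monoid: "(a, b) \<in> (- I)\<^sup>*"
    and letters_accessible:
      "\<exists>u\<in>carrier (trace_monoid I). u \<otimes>\<^bsub>trace_monoid I\<^esub> trace_of I [a] \<in> enabled I act \<alpha>"


section \<open>Markov measures and stable state-and-cliques\<close>

definition markov_measure ::
  "('a \<times> 'a) set \<Rightarrow> ('s option \<Rightarrow> 'a list set \<Rightarrow> 's option) \<Rightarrow>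
   ('s \<Rightarrow> (nat \<Rightarrow> 'a set) measure) \<Rightarrow> bool" where
  "markov_measure I act \<nu> \<longleftrightarrow>
     (\<forall>\<alpha>. prob_space (\<nu> \<alpha>) \<and> sets (\<nu> \<alpha>) = sets (inf_trace_borel I)) \<and>
     (\<forall>\<alpha>. measure (\<nu> \<alpha>) (inf_enabled I act \<alpha>) = 1) \<and>
     (\<forall>\<alpha>. \<forall>x\<in>carrier (trace_monoid I).
        x \<in> enabled I act \<alpha> \<longleftrightarrow> measure (\<nu> \<alpha>) (up_set I x) > 0) \<and>
     (\<forall>\<alpha>. \<forall>x\<in>carrier (trace_monoid I). \<forall>y\<in>carrier (trace_monoid I).
        measure (\<nu> \<alpha>) (up_set I (x \<otimes>\<^bsub>trace_monoid I\<^esub> y)) =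
          (case act (Some \<alpha>) x of
             None \<Rightarrow> 0
           | Some \<beta> \<Rightarrow> measure (\<nu> \<alpha>) (up_set I x) * measure (\<nu> \<beta>) (up_set I y)))"

definition state_clique ::
  "('a \<times> 'a) set \<Rightarrow> ('s option \<Rightarrow> 'a list set \<Rightarrow> 's option) \<Rightarrow> 's \<times> 'a set \<Rightarrow> bool" where
  "state_clique I act = (\<lambda>(\<alpha>, c). clique I c \<and> c \<noteq> {} \<and> act (Some \<alpha>) (clique_trace I c) \<noteq> None)"

definition stable_state_clique ::
  "('a \<times> 'a) set \<Rightarrow> ('s option \<Rightarrow> 'a list set \<Rightarrow> 's option) \<Rightarrow> 's \<times> 'a set \<Rightarrow> bool" where
  "stable_state_clique I act = (\<lambda>(\<alpha>, c). state_clique I act (\<alpha>, c) \<and>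
     (\<exists>x\<in>enabled I act \<alpha>. \<forall>z\<in>enabled I act \<alpha>.
        x divides\<^bsub>trace_monoid I\<^esub> z \<longrightarrow> nf_clique I z 0 = c))"

text \<open>The state $\alpha_i$ along \<open>\<omega>\<close> started in \<open>\<alpha>\<close>; it differs from \<^const>\<open>None\<close> whenever
  \<open>\<omega> \<in> inf_enabled I act \<alpha>\<close>.\<close>

primrec state_at ::
  "('a \<times> 'a) set \<Rightarrow> ('s option \<Rightarrow> 'a list set \<Rightarrow> 's option) \<Rightarrow> 's \<Rightarrow> (nat \<Rightarrow> 'a set) \<Rightarrow>
   nat \<Rightarrow> 's option" where
  "state_at I act \<alpha> \<omega> 0 = Some \<alpha>"
| "state_at I act \<alpha> \<omega> (Suc i) = act (state_at I act \<alpha> \<omega> i) (clique_trace I (\<omega> i))"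

end

theory Submission imports Defs "HOL-Library.Sublist" begin

text \<open>
  The proof separates a combinatorial and a probabilistic statement.

  Combinatorially, let \<open>\<omega>\<close> be an infinite trace all of whose finite prefixes are enabled at \<open>\<alpha>\<close>,
  and suppose that every letter occurs in infinitely many cliques of \<open>\<omega>\<close>. Then every
  state-and-clique along \<open>\<omega>\<close> is stable (\<open>stable_if_all_letters_recur\<close>). To see this at index \<open>i\<close>,
  take a finite segment \<open>y\<close> of \<open>\<omega>\<close>, starting at clique \<open>i\<close>, in which every letter occurs. The first
  clique of a trace \<open>z\<close> consists of the letters below \<open>z\<close>. If \<open>y \<le> z\<close> and the letter \<open>b\<close> lies
  below \<open>z\<close>, then the first \<open>b\<close> of \<open>z\<close> is one of the occurrences in \<open>y\<close>, so \<open>b\<close> lies below \<open>y\<close>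
  already. Hence \<open>z\<close> has the same first clique as \<open>y\<close>, which is \<open>\<omega> i\<close>: the trace \<open>y\<close> witnesses
  stability.

  It remains to see that almost surely every letter recurs (\<open>AE_all_letters_recur\<close>). Some letter
  recurs because the alphabet is finite, and the dependence graph is connected, so it suffices that
  for distinct dependent letters \<open>a\<close>, \<open>b\<close> it has probability zero that \<open>a\<close> recurs while \<open>b\<close> occurs only
  finitely often. Let \<open>avoiding a b k\<close> be the event that some finite prefix contains \<open>k\<close> times the
  letter \<open>a\<close> and no \<open>b\<close>. Among such prefixes there is a least one, so the event is a disjoint union of
  cylinders; since cylinders are the sets on which the Markov property is given, this yields
  \<open>\<nu>\<^sub>\<alpha>(avoiding a b (k + l)) \<le> \<nu>\<^sub>\<alpha>(avoiding a b k) \<cdot> max\<^sub>\<beta> \<nu>\<^sub>\<beta>(avoiding a b l)\<close>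
  (\<open>emeasure_avoiding_add_le\<close>). From every state \<open>\<beta>\<close> some \<open>u\<close> with \<open>ub\<close> enabled exists. The cylinder of
  \<open>ub\<close> has positive probability, and it does not meet \<open>avoiding a b k\<close> as soon as \<open>k\<close> exceeds the number
  of \<open>a\<close> in \<open>u\<close>, because the order between the \<open>a\<close> and \<open>b\<close> of a trace is fixed. So the maximum is
  less than \<open>1\<close> for some \<open>l\<close> (\<open>avoiding_uniformly_small\<close>), and the probabilities decrease to zero
  geometrically.

  The combinatorics of traces is carried out on words, through their projections to pairs of
  dependent letters.
\<close>

section \<open>Words of cliques\<close>

abbreviation pair_proj :: "'a \<Rightarrow> 'a \<Rightarrow> 'a list \<Rightarrow> 'a list" where
  "pair_proj a b \<equiv> filter (\<lambda>c. c = a \<or> c = b)"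

definition clique_word :: "'a set \<Rightarrow> 'a list" where
  "clique_word c = (SOME w. distinct w \<and> set w = c)"

definition word_of :: "'a set list \<Rightarrow> 'a list" where
  "word_of cs = concat (map clique_word cs)"

lemma word_of_simps [simp]:
  "word_of [] = []"
  "word_of (c # cs) = clique_word c @ word_of cs"
  "word_of (cs @ ds) = word_of cs @ word_of ds"
  by (simp_all add: word_of_def)

lemma clique_word:
  fixes c :: "'a::finite set"
  shows "distinct (clique_word c)" "set (clique_word c) = c"
proof -
  obtain w where "distinct w \<and> set w = c"
    using finite_distinct_list[of c] by auto
  then have "distinct (clique_word c) \<and> set (clique_word c) = c"
    unfolding clique_word_def by (rule someI)
  then show "distinct (clique_word c)" "set (clique_word c) = c"
    by auto
qed

lemma set_word_of: "set (word_of (cs :: 'a::finite set list)) = \<Union> (set cs)"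
  by (induction cs) (auto simp: clique_word)

lemma clique_trace_eq_trace_of: "clique_trace I c = trace_of I (clique_word c)"
  by (simp add: clique_trace_def clique_word_def)

lemma clique_prod_eq_trace_of: "clique_prod I cs = trace_of I (word_of cs)"
  by (induction cs)
    (simp_all add: clique_prod_def clique_trace_eq_trace_of one_trace_monoid mult_trace_monoid)

lemma length_trace_cong: "(u, v) \<in> trace_cong I \<Longrightarrow> length u = length v"
  by (induction rule: trace_cong.induct) auto

section \<open>Divisibility of traces through projections to dependent pairs\<close>

locale independence =
  fixes I :: "('a::finite \<times> 'a) set"
  assumes irrefl_indep: "irrefl I" and sym_indep: "sym I"
begin

text \<open>This is left divisibility of the traces of two words (\<open>divides_iff_trace_le\<close> below). With
  projections, left cancellation and invariance under the trace congruence are immediate.\<close>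

definition trace_le :: "'a list \<Rightarrow> 'a list \<Rightarrow> bool" where
  "trace_le u v \<longleftrightarrow> (\<forall>a b. (a, b) \<notin> I \<longrightarrow> prefix (pair_proj a b u) (pair_proj a b v))"

lemma not_self_indep [simp]: "(a, a) \<notin> I"
  using irrefl_indep by (auto simp: irrefl_def)

lemma indep_sym: "(a, b) \<in> I \<Longrightarrow> (b, a) \<in> I"
  using sym_indep by (auto simp: sym_def)

lemma trace_le_refl [simp]: "trace_le u u"
  by (simp add: trace_le_def)

lemma trace_le_trans: "trace_le u v \<Longrightarrow> trace_le v w \<Longrightarrow> trace_le u w"
  unfolding trace_le_def by (meson prefix_order.trans)

lemma trace_le_append [simp]: "trace_le u (u @ v)"
  by (simp add: trace_le_def)

lemma trace_le_cancel [simp]: "trace_le (w @ u) (w @ v) \<longleftrightarrow> trace_le u v"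
  by (simp add: trace_le_def)

lemma trace_le_cancel_Cons [simp]: "trace_le (c # u) (c # v) \<longleftrightarrow> trace_le u v"
  using trace_le_cancel[of "[c]"] by simp

text \<open>A swap exchanges two distinct independent letters, and a dependent pair never contains both.\<close>

lemma pair_proj_trace_cong:
  assumes "(u, v) \<in> trace_cong I" "(a, b) \<notin> I"
  shows "pair_proj a b u = pair_proj a b v"
  using assms(1)
proof (induction rule: trace_cong.induct)
  case (swap c d u v)
  then have "\<not> ((c = a \<or> c = b) \<and> (d = a \<or> d = b))"
    using assms(2) indep_sym by auto
  then show ?case by auto
qed auto

lemma trace_cong_imp_trace_le: "(u, v) \<in> trace_cong I \<Longrightarrow> trace_le u v"
  by (simp add: trace_le_def pair_proj_trace_cong)

lemma count_list_pair_proj: "count_list w a = length (pair_proj a a w)"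
  by (induction w) auto

lemma trace_le_count: "trace_le u v \<Longrightarrow> count_list u a \<le> count_list v a"
  unfolding trace_le_def count_list_pair_proj using not_self_indep prefix_length_le by blast

lemma trace_le_set: "trace_le u v \<Longrightarrow> set u \<subseteq> set v"
  using trace_le_count by (metis count_list_0_iff le_zero_eq subsetI)

lemma not_prefix_later_letter:
  assumes "prefix (c # xs) (pair_proj c d (v1 @ v))" "c \<notin> set v1" "d \<in> set v1"
  shows False
proof -
  have "pair_proj c d v1 \<noteq> []" "set (pair_proj c d v1) \<subseteq> {d}"
    using assms(2,3) by (auto simp: filter_empty_conv)
  moreover have "hd (pair_proj c d (v1 @ v)) = c"
    using assms(1) by (auto simp: prefix_def)
  ultimately show False
    using assms(2,3) by (metis filter_append hd_append2 hd_in_set singletonD subsetD)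
qed

text \<open>The diagonal pair \<open>(c, c)\<close> shows that \<open>c\<close> occurs in \<open>v\<close>. A letter \<open>d\<close> before the first \<open>c\<close> that
  depends on \<open>c\<close> would come first in the projection of \<open>v\<close> to \<open>{c, d}\<close>, whereas \<open>c\<close> does so on the
  left.\<close>

lemma trace_le_Cons_split:
  assumes "trace_le (c # u) v"
  obtains v1 v2 where "v = v1 @ c # v2" "\<And>d. d \<in> set v1 \<Longrightarrow> (c, d) \<in> I"
proof -
  have "c \<in> set v"
    using trace_le_set[OF assms] by auto
  then obtain v1 v2 where v: "v = v1 @ c # v2" "c \<notin> set v1"
    by (metis split_list_first)
  have "(c, d) \<in> I" if "d \<in> set v1" for d
  proof (rule ccontr)
    assume "(c, d) \<notin> I"
    then have "prefix (c # pair_proj c d u) (pair_proj c d (v1 @ c # v2))"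
      using assms unfolding trace_le_def v(1) by force
    then show False
      using not_prefix_later_letter that v(2) by metis
  qed
  then show thesis
    using that v(1) by blast
qed

lemma trace_cong_front:
  "(\<And>d. d \<in> set v1 \<Longrightarrow> (c, d) \<in> I) \<Longrightarrow> (v1 @ c # v2, c # v1 @ v2) \<in> trace_cong I"
  by (intro trace_cong.sym[OF trace_cong_move]) auto

lemma trace_le_singleton_iff:
  "trace_le [b] w \<longleftrightarrow> (\<exists>w1 w2. w = w1 @ b # w2 \<and> (\<forall>d\<in>set w1. (b, d) \<in> I))" (is "_ \<longleftrightarrow> ?R")
proof
  show "trace_le [b] w \<Longrightarrow> ?R"
    using trace_le_Cons_split by metis
next
  assume ?R
  then obtain w1 w2 where w: "w = w1 @ b # w2" "\<forall>d\<in>set w1. (b, d) \<in> I"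
    by blast
  then have "(b # w1 @ w2, w) \<in> trace_cong I"
    using trace_cong_front[of w1 b w2] by (simp add: trace_cong.sym)
  then show "trace_le [b] w"
    using trace_le_append[of "[b]" "w1 @ w2"] trace_cong_imp_trace_le trace_le_trans by fastforce
qed

lemma trace_le_Cons_obtain:
  assumes "trace_le [c] v"
  obtains v' where "(v, c # v') \<in> trace_cong I"
  using assms trace_cong_front unfolding trace_le_singleton_iff by blast

lemma trace_le_cong_right: "(v, v') \<in> trace_cong I \<Longrightarrow> trace_le u v \<longleftrightarrow> trace_le u v'"
  by (simp add: pair_proj_trace_cong trace_le_def)

lemma trace_le_cong_left: "(u, u') \<in> trace_cong I \<Longrightarrow> trace_le u v \<longleftrightarrow> trace_le u' v"
  by (simp add: pair_proj_trace_cong trace_le_def)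

text \<open>The quotient is found by moving the letters of \<open>u\<close> to the front of \<open>v\<close> one after the other.\<close>

lemma trace_le_imp_trace_cong: "trace_le u v \<Longrightarrow> \<exists>w. (u @ w, v) \<in> trace_cong I"
proof (induction u arbitrary: v)
  case Nil
  show ?case by (auto intro: trace_cong.refl)
next
  case (Cons c u)
  have "trace_le [c] v"
    using Cons.prems trace_le_append[of "[c]" u] trace_le_trans by fastforce
  then obtain v' where v': "(v, c # v') \<in> trace_cong I"
    by (rule trace_le_Cons_obtain)
  have "trace_le u v'"
    using Cons.prems unfolding trace_le_cong_right[OF v'] by simp
  then obtain w where "(u @ w, v') \<in> trace_cong I"
    using Cons.IH by blast
  then have "(c # u @ w, c # v') \<in> trace_cong I"
    using trace_cong_context[of "u @ w" v' I "[c]" "[]"] by simp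
  then have "((c # u) @ w, v) \<in> trace_cong I"
    using v' by (auto intro: trace_cong.sym trace_cong.trans)
  then show ?case ..
qed

lemma trace_le_antisym:
  assumes "trace_le u v" "trace_le v u"
  shows "(u, v) \<in> trace_cong I"
proof -
  obtain w where w: "(u @ w, v) \<in> trace_cong I"
    using assms(1) trace_le_imp_trace_cong by blast
  have "count_list w a = 0" for a
    using trace_le_count[OF assms(2), of a] trace_le_count[OF trace_cong_imp_trace_le[OF w], of a] by simp
  then have "w = []"
    by (metis count_list_0_iff last_in_set)
  then show ?thesis
    using w by simp
qed

lemma divides_iff_trace_le:
  "trace_of I u divides\<^bsub>trace_monoid I\<^esub> trace_of I v \<longleftrightarrow> trace_le u v"
proof
  assume "trace_of I u divides\<^bsub>trace_monoid I\<^esub> trace_of I v"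
  then obtain w where "trace_of I v = trace_of I (u @ w)"
    by (auto simp: factor_def carrier_trace_monoid mult_trace_monoid)
  then show "trace_le u v"
    using trace_le_cong_right trace_le_append by (metis trace_of_eq_iff)
next
  assume "trace_le u v"
  then obtain w where "trace_of I (u @ w) = trace_of I v"
    using trace_le_imp_trace_cong trace_of_eq_iff by blast
  then have "trace_of I v = trace_of I u \<otimes>\<^bsub>trace_monoid I\<^esub> trace_of I w"
    by (simp add: mult_trace_monoid)
  then show "trace_of I u divides\<^bsub>trace_monoid I\<^esub> trace_of I v"
    unfolding factor_def carrier_trace_monoid by blast
qed

lemma trace_le_singleton_append_iff:
  "trace_le [b] (u @ v) \<longleftrightarrow> trace_le [b] u \<or> (\<forall>d\<in>set u. (b, d) \<in> I) \<and> trace_le [b] v"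
  (is "_ \<longleftrightarrow> ?R")
proof
  assume "trace_le [b] (u @ v)"
  then obtain w1 w2 where w: "u @ v = w1 @ b # w2" "\<forall>d\<in>set w1. (b, d) \<in> I"
    unfolding trace_le_singleton_iff by blast
  from w(1) consider us where "u = w1 @ b # us" | vs where "w1 = u @ vs" "v = vs @ b # w2"
    by (auto simp: append_eq_append_conv2 append_eq_Cons_conv)
  then show ?R
    using w(2) by cases (auto simp: trace_le_singleton_iff)
next
  assume ?R
  then show "trace_le [b] (u @ v)"
  proof
    assume "trace_le [b] u"
    then show ?thesis using trace_le_append trace_le_trans by blast
  next
    assume *: "(\<forall>d\<in>set u. (b, d) \<in> I) \<and> trace_le [b] v"
    then obtain w1 w2 where "v = w1 @ b # w2" "\<forall>d\<in>set w1. (b, d) \<in> I"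
      unfolding trace_le_singleton_iff by blast
    then have "u @ v = (u @ w1) @ b # w2" "\<forall>d\<in>set (u @ w1). (b, d) \<in> I"
      using * by auto
    then show ?thesis
      unfolding trace_le_singleton_iff by blast
  qed
qed

text \<open>If \<open>b\<close> occurs in \<open>y\<close>, then nothing multiplied to \<open>y\<close> from the right can make \<open>b\<close>
  minimal unless it already is. Stability rests on this.\<close>

lemma trace_le_singleton_of_trace_le:
  assumes "trace_le y w" "trace_le [b] w" "b \<in> set y"
  shows "trace_le [b] y"
proof -
  obtain z where z: "(y @ z, w) \<in> trace_cong I"
    using assms(1) trace_le_imp_trace_cong by blast
  then have "trace_le [b] (y @ z)"
    using assms(2) trace_le_cong_right by blast
  then show ?thesis
    using assms(3) by (auto simp: trace_le_singleton_append_iff)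
qed

lemma trace_le_indep_Cons_iff:
  assumes "\<And>d. d \<in> set w \<Longrightarrow> (c, d) \<in> I"
  shows "trace_le w (c # v) \<longleftrightarrow> trace_le w v"
proof -
  have "prefix (pair_proj a b w) (pair_proj a b (c # v))
      \<longleftrightarrow> prefix (pair_proj a b w) (pair_proj a b v)"
    if ab: "(a, b) \<notin> I" for a b
  proof (cases "c = a \<or> c = b")
    case True
    then have "\<forall>d\<in>set w. \<not> (d = a \<or> d = b)"
      using assms ab indep_sym not_self_indep by blast
    then have "pair_proj a b w = []"
      by (simp add: filter_empty_conv)
    then show ?thesis by simp
  qed auto
  then show ?thesis
    unfolding trace_le_def by blast
qed

text \<open>Two prefixes of the same trace have a meet, in which the letter counts are the minima: regarding
  \<open>v\<close> as a partially ordered set of occurrences, \<open>x\<close> and \<open>y\<close> are down-sets, and the meet is their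
  intersection. The induction peels off the first letter \<open>c\<close> of \<open>x\<close>, which is minimal in \<open>v\<close>. It is
  either minimal in \<open>y\<close> as well, or it does not occur in \<open>y\<close>; then it commutes with all of \<open>y\<close> and
  does not contribute to the meet.\<close>

lemma trace_le_meet:
  "trace_le x v \<Longrightarrow> trace_le y v \<Longrightarrow>
    \<exists>m. trace_le m x \<and> trace_le m y \<and>
      (\<forall>c. count_list m c = min (count_list x c) (count_list y c))"
proof (induction x arbitrary: y v)
  case Nil
  show ?case by (intro exI[of _ "[]"]) (simp add: trace_le_def)
next
  case (Cons c x)
  have cv: "trace_le [c] v"
    using Cons.prems(1) trace_le_append[of "[c]" x] trace_le_trans by fastforce
  then obtain v' where v': "(v, c # v') \<in> trace_cong I"
    by (rule trace_le_Cons_obtain)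
  have xv': "trace_le x v'"
    using Cons.prems(1) unfolding trace_le_cong_right[OF v'] by simp
  show ?case
  proof (cases "c \<in> set y")
    case True
    then have "trace_le [c] y"
      using trace_le_singleton_of_trace_le Cons.prems(2) cv by blast
    then obtain y' where y': "(y, c # y') \<in> trace_cong I"
      by (rule trace_le_Cons_obtain)
    have "trace_le y' v'"
      using Cons.prems(2) unfolding trace_le_cong_right[OF v'] trace_le_cong_left[OF y'] by simp
    then obtain m where m: "trace_le m x" "trace_le m y'"
        "\<And>d. count_list m d = min (count_list x d) (count_list y' d)"
      using Cons.IH[OF xv'] by blast
    have "count_list y d = count_list (c # y') d" for d
      unfolding count_list_pair_proj by (rule arg_cong[OF pair_proj_trace_cong[OF y' not_self_indep]])
    moreover have "trace_le (c # m) y"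
      unfolding trace_le_cong_right[OF y'] using m(2) by simp
    ultimately show ?thesis
      using m by (intro exI[of _ "c # m"]) simp
  next
    case False
    obtain z where z: "(y @ z, v) \<in> trace_cong I"
      using Cons.prems(2) trace_le_imp_trace_cong by blast
    then have "trace_le [c] (y @ z)"
      using cv trace_le_cong_right by blast
    then have indep: "\<forall>d\<in>set y. (c, d) \<in> I"
      using False trace_le_set[of "[c]" y] by (auto simp: trace_le_singleton_append_iff)
    have "trace_le y (c # v')"
      using Cons.prems(2) unfolding trace_le_cong_right[OF v'] .
    then have "trace_le y v'"
      using indep trace_le_indep_Cons_iff by blast
    then obtain m where m: "trace_le m x" "trace_le m y"
        "\<And>d. count_list m d = min (count_list x d) (count_list y d)"
      using Cons.IH[OF xv'] by blast
    have "trace_le m (c # x)"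
      using trace_le_indep_Cons_iff[of m c x] trace_le_set[OF m(2)] indep m(1) by blast
    moreover have "count_list y c = 0"
      using False by (simp add: count_list_0_iff)
    ultimately show ?thesis
      using m by (intro exI[of _ m]) auto
  qed
qed

section \<open>Normal forms\<close>

lemma trace_le_words_of_singletons:
  "distinct u \<Longrightarrow> (\<And>b. b \<in> set u \<Longrightarrow> trace_le [b] w) \<Longrightarrow> trace_le u w"
proof (induction u arbitrary: w)
  case Nil
  show ?case by (simp add: trace_le_def)
next
  case (Cons b u)
  then obtain w' where w': "(w, b # w') \<in> trace_cong I"
    by (metis list.set_intros(1) trace_le_Cons_obtain)
  have "trace_le [d] w'" if "d \<in> set u" for d
  proof -
    have "trace_le [d] ([b] @ w')"
      using Cons.prems(2)[of d] that w' trace_le_cong_right by simp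
    moreover have "\<not> trace_le [d] [b]"
      using that Cons.prems(1) trace_le_set[of "[d]" "[b]"] by auto
    ultimately show ?thesis
      unfolding trace_le_singleton_append_iff by blast
  qed
  then have "trace_le u w'"
    using Cons by auto
  then show ?case
    unfolding trace_le_cong_right[OF w'] by simp
qed

lemma clique_min_letters: "clique I {b. trace_le [b] w}"
  unfolding clique_def
proof (intro conjI ballI impI)
  fix a b assume *: "a \<in> {b. trace_le [b] w}" "b \<in> {b. trace_le [b] w}" "a \<noteq> b"
  show "(a, b) \<in> I"
  proof (rule ccontr)
    assume "(a, b) \<notin> I"
    then have "prefix [a] (pair_proj a b w)" "prefix [b] (pair_proj a b w)"
      using * unfolding trace_le_def by force+
    then show False
      using \<open>a \<noteq> b\<close> by (auto simp: prefix_def)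
  qed
qed simp

lemma trace_le_singleton_clique_word:
  assumes "clique I c" "b \<in> c"
  shows "trace_le [b] (clique_word c)"
proof -
  obtain w1 w2 where "clique_word c = w1 @ b # w2"
    using assms(2) clique_word(2) split_list by metis
  moreover have "distinct (w1 @ b # w2)" "set (w1 @ b # w2) = c"
    using clique_word[of c] calculation by simp_all
  ultimately show ?thesis
    using assms(1) unfolding trace_le_singleton_iff clique_def by fastforce
qed

definition normal :: "'a set list \<Rightarrow> bool" where
  "normal cs \<longleftrightarrow> (\<forall>c\<in>set cs. clique I c \<and> c \<noteq> {}) \<and> successively (clique_step I) cs"

lemma normal_form_iff: "normal_form I x cs \<longleftrightarrow> normal cs \<and> x = trace_of I (word_of cs)"
  unfolding normal_form_def normal_def clique_prod_eq_trace_of successively_conv_nth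
  by (auto simp: less_diff_conv)

text \<open>A letter below the product that is missing in \<open>c\<close> would be independent of all of \<open>c\<close> and lie
  below the remaining product, hence, inductively, in the second clique, against \<open>clique_step\<close>.\<close>

lemma normal_first_clique:
  "normal (c # cs) \<Longrightarrow> trace_le [b] (word_of (c # cs)) \<longleftrightarrow> b \<in> c"
proof (induction cs arbitrary: c)
  case Nil
  then show ?case
    using trace_le_set[of "[b]" "clique_word c"] trace_le_singleton_clique_word[of c b]
    by (auto simp: normal_def clique_word)
next
  case (Cons d cs)
  have step: "clique_step I c d" and nf: "normal (d # cs)" and c: "clique I c"
    using Cons.prems by (auto simp: normal_def)
  show ?case
  proof
    assume "b \<in> c"
    then show "trace_le [b] (word_of (c # d # cs))"
      using trace_le_singleton_clique_word[OF c] by (simp add: trace_le_singleton_append_iff)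
  next
    assume le: "trace_le [b] (word_of (c # d # cs))"
    show "b \<in> c"
    proof (rule ccontr)
      assume "b \<notin> c"
      then have "\<not> trace_le [b] (clique_word c)"
        using trace_le_set[of "[b]" "clique_word c"] by (auto simp: clique_word)
      then have "\<forall>e\<in>c. (b, e) \<in> I" "trace_le [b] (word_of (d # cs))"
        using le by (auto simp: trace_le_singleton_append_iff clique_word)
      then show False
        using step indep_sym unfolding Cons.IH[OF nf] clique_step_def by blast
    qed
  qed
qed

text \<open>The first clique is determined by the trace as its set of minimal letters; the rest is determined
  by left cancellation.\<close>

lemma normal_unique:
  "normal cs \<Longrightarrow> normal ds \<Longrightarrow> (word_of cs, word_of ds) \<in> trace_cong I \<Longrightarrow> cs = ds"
proof (induction cs arbitrary: ds)
  case Nil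
  then have "word_of ds = []"
    using length_trace_cong by fastforce
  then have "\<Union> (set ds) = {}"
    by (metis set_empty set_word_of)
  then show ?case
    using Nil.prems(2) by (cases ds) (auto simp: normal_def)
next
  case (Cons c cs)
  have "set (word_of (c # cs)) \<noteq> {}"
    using Cons.prems(1) by (auto simp: set_word_of normal_def clique_word)
  then have "ds \<noteq> []"
    using length_trace_cong[OF Cons.prems(3)] by auto
  then obtain d ds' where ds: "ds = d # ds'"
    by (cases ds) auto
  have cd: "c = d"
    using normal_first_clique[OF Cons.prems(1)] normal_first_clique Cons.prems(2)
      trace_le_cong_right[OF Cons.prems(3)] unfolding ds by blast
  have "trace_le (word_of cs) (word_of ds')" "trace_le (word_of ds') (word_of cs)"
    using trace_cong_imp_trace_le[OF Cons.prems(3)]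
      trace_cong_imp_trace_le[OF trace_cong.sym[OF Cons.prems(3)]]
    unfolding ds cd by simp_all
  then have "(word_of cs, word_of ds') \<in> trace_cong I"
    by (rule trace_le_antisym)
  moreover have "normal cs" "normal ds'"
    using Cons.prems(1,2) unfolding ds by (auto simp: normal_def successively_Cons)
  ultimately show ?case
    using Cons.IH cd ds by blast
qed

text \<open>The greedy construction: split off all minimal letters at once. A minimal letter of the quotient
  that was independent of all of them would have been minimal from the start.\<close>

lemma normal_exists: "\<exists>cs. normal cs \<and> (word_of cs, w) \<in> trace_cong I"
proof (induction "length w" arbitrary: w rule: less_induct)
  case less
  show ?case
  proof (cases w)
    case Nil
    then show ?thesis
      by (intro exI[of _ "[]"]) (simp add: normal_def trace_cong.refl)
  next
    case (Cons e es)
    define c where "c = {b. trace_le [b] w}"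
    have "e \<in> c"
      using trace_le_append[of "[e]" es] by (simp add: c_def Cons)
    have "trace_le (clique_word c) w"
      by (rule trace_le_words_of_singletons) (auto simp: clique_word c_def)
    then obtain w' where w': "(clique_word c @ w', w) \<in> trace_cong I"
      using trace_le_imp_trace_cong by blast
    have "clique_word c \<noteq> []"
      using \<open>e \<in> c\<close> by (metis clique_word(2) empty_iff empty_set)
    then have "length w' < length w"
      using length_trace_cong[OF w'] by (cases "clique_word c") auto
    then obtain cs where cs: "normal cs" "(word_of cs, w') \<in> trace_cong I"
      using less by blast
    have step: "clique_step I c (hd cs)" if "cs \<noteq> []"
      unfolding clique_step_def
    proof (intro ballI, rule ccontr)
      fix d assume d: "d \<in> hd cs" "\<not> (\<exists>a\<in>c. (a, d) \<notin> I)"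
      have "trace_le [d] (word_of cs)"
        using normal_first_clique[of "hd cs" "tl cs"] that cs(1) d(1) by simp
      then have "trace_le [d] w'"
        using trace_le_cong_right[OF cs(2)] by blast
      then have "trace_le [d] (clique_word c @ w')"
        using d(2) indep_sym unfolding trace_le_singleton_append_iff clique_word(2) by blast
      then have "d \<in> c"
        unfolding trace_le_cong_right[OF w'] by (simp add: c_def)
      then show False
        using d(2) by auto
    qed
    have "normal (c # cs)"
      using cs(1) step clique_min_letters[of w] \<open>e \<in> c\<close>
      unfolding normal_def successively_Cons c_def[symmetric] by auto
    moreover have "(word_of (c # cs), w) \<in> trace_cong I"
      using trace_cong_context[OF cs(2), of "clique_word c" "[]"] w'
      by (auto intro: trace_cong.trans)
    ultimately show ?thesis by blast
  qed
qed

lemma nf_clique_0: "nf_clique I (trace_of I w) 0 = {b. trace_le [b] w}"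
proof -
  obtain cs where cs: "normal cs" "(word_of cs, w) \<in> trace_cong I"
    using normal_exists by blast
  have "(THE cs. normal_form I (trace_of I w) cs) = cs"
  proof (rule the_equality)
    show "normal_form I (trace_of I w) cs"
      using cs by (simp add: normal_form_iff trace_of_eq_iff trace_cong.sym)
    fix ds assume "normal_form I (trace_of I w) ds"
    then have "normal ds" "(word_of ds, word_of cs) \<in> trace_cong I"
      using cs(2) by (auto simp: normal_form_iff trace_of_eq_iff intro: trace_cong.sym trace_cong.trans)
    then show "ds = cs"
      using cs(1) normal_unique by blast
  qed
  moreover have "{b. trace_le [b] w} = (if 0 < length cs then cs ! 0 else {})"
  proof (cases cs)
    case Nil
    then have "w = []"
      using length_trace_cong[OF cs(2)] by simp
    then show ?thesis
      using Nil trace_le_set[of _ "[]"] by fastforce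
  next
    case (Cons c cs')
    then show ?thesis
      using cs normal_first_clique trace_le_cong_right[OF cs(2)] by auto
  qed
  ultimately show ?thesis
    by (simp add: nf_clique_def Let_def)
qed

section \<open>Recurrence of all letters implies stability\<close>

definition prefix_word :: "(nat \<Rightarrow> 'a set) \<Rightarrow> nat \<Rightarrow> 'a list" where
  "prefix_word \<omega> n = word_of (map \<omega> [0..<n])"

lemma prefix_word_split: "m \<le> n \<Longrightarrow> prefix_word \<omega> n = prefix_word \<omega> m @ word_of (map \<omega> [m..<n])"
  using upt_add_eq_append[of 0 m "n - m"] by (simp add: prefix_word_def)

lemma prefix_word_mono: "m \<le> n \<Longrightarrow> trace_le (prefix_word \<omega> m) (prefix_word \<omega> n)"
  by (simp add: prefix_word_split)

lemma trace_below_iff: "trace_below I (trace_of I w) \<omega> \<longleftrightarrow> (\<exists>n. trace_le w (prefix_word \<omega> n))"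
  by (simp add: trace_below_def clique_prod_eq_trace_of divides_iff_trace_le prefix_word_def)

lemma normal_segment: "\<omega> \<in> inf_traces I \<Longrightarrow> normal (map \<omega> [m..<n])"
  unfolding normal_def successively_conv_nth inf_traces_def by auto

end

sublocale concurrent_system \<subseteq> independence I
  by unfold_locales (fact irrefl_indep sym_indep)+

context concurrent_system
begin

lemma trace_of_in_carrier [simp]: "trace_of I w \<in> carrier (trace_monoid I)"
  by (simp add: carrier_trace_monoid)

lemma act_append: "act p (trace_of I (u @ v)) = act (act p (trace_of I u)) (trace_of I v)"
  using act_mult[of "trace_of I u" "trace_of I v" p] by (simp add: mult_trace_monoid)

lemma enabled_iff: "trace_of I w \<in> enabled I act \<alpha> \<longleftrightarrow> act (Some \<alpha>) (trace_of I w) \<noteq> None"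
  by (simp add: enabled_def)

lemma state_at_eq: "state_at I act \<alpha> \<omega> n = act (Some \<alpha>) (trace_of I (prefix_word \<omega> n))"
proof (induction n)
  case 0
  show ?case using act_one[of "Some \<alpha>"] by (simp add: prefix_word_def one_trace_monoid)
next
  case (Suc n)
  have "prefix_word \<omega> (Suc n) = prefix_word \<omega> n @ clique_word (\<omega> n)"
    by (simp add: prefix_word_def)
  then show ?case
    using Suc by (simp add: act_append clique_trace_eq_trace_of)
qed

text \<open>The witness for stability is a segment \<open>y\<close> of \<open>\<omega>\<close> that starts at clique \<open>i\<close> and is long enough to
  contain every letter. No enabled extension of \<open>y\<close> can acquire a new minimal letter.\<close>

lemma stable_if_all_letters_recur:
  assumes \<omega>: "\<omega> \<in> inf_enabled I act \<alpha>"
    and recur: "\<And>a. infinite {i. a \<in> \<omega> i}"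
  shows "\<exists>\<beta>. state_at I act \<alpha> \<omega> i = Some \<beta> \<and> stable_state_clique I act (\<beta>, \<omega> i)"
proof -
  have inf: "\<omega> \<in> inf_traces I"
    using \<omega> by (simp add: inf_enabled_def)
  have alive: "act (Some \<alpha>) (trace_of I (prefix_word \<omega> n)) \<noteq> None" for n
  proof -
    have "trace_of I (prefix_word \<omega> n) \<in> enabled I act \<alpha>"
      using \<omega> trace_le_refl unfolding inf_enabled_def mem_Collect_eq
      by (meson trace_below_iff trace_of_in_carrier)
    then show ?thesis by (simp add: enabled_iff)
  qed
  then obtain \<beta> where \<beta>: "act (Some \<alpha>) (trace_of I (prefix_word \<omega> i)) = Some \<beta>"
    by blast
  have "\<exists>j\<ge>i. a \<in> \<omega> j" for a
    using recur[of a] by (auto simp: infinite_nat_iff_unbounded_le)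
  then obtain j where j: "\<And>a. j a \<ge> i" "\<And>a. a \<in> \<omega> (j a)"
    by metis
  define n where "n = Suc (Max (insert i (range j)))"
  have n: "i < n" "j a < n" for a
    unfolding n_def less_Suc_eq_le by (rule Max_ge; simp)+
  define y where "y = word_of (map \<omega> [i..<n])"
  have y_letters: "a \<in> set y" for a
    using j[of a] n(2)[of a] unfolding y_def set_word_of by auto
  have y_first: "trace_le [b] y \<longleftrightarrow> b \<in> \<omega> i" for b
    using normal_first_clique[of "\<omega> i" "map \<omega> [Suc i..<n]" b] normal_segment[OF inf, of i n] n(1)
    unfolding y_def by (simp add: upt_conv_Cons)
  have "act (Some \<beta>) (trace_of I y) \<noteq> None"
    using alive[of n] n(1) unfolding y_def by (simp add: prefix_word_split[of i n] act_append \<beta>)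
  then have "trace_of I y \<in> enabled I act \<beta>"
    by (simp add: enabled_iff)
  moreover have "nf_clique I z 0 = \<omega> i"
    if z: "z \<in> enabled I act \<beta>" "trace_of I y divides\<^bsub>trace_monoid I\<^esub> z" for z
  proof -
    obtain w where w: "z = trace_of I w"
      using z(1) by (auto simp: enabled_def carrier_trace_monoid)
    then have "trace_le y w"
      using z(2) by (simp add: divides_iff_trace_le)
    then have "trace_le [b] w \<longleftrightarrow> trace_le [b] y" for b
      using trace_le_singleton_of_trace_le y_letters trace_le_trans by blast
    then show ?thesis
      by (auto simp: w nf_clique_0 y_first)
  qed
  moreover have "state_clique I act (\<beta>, \<omega> i)"
    using inf alive[of "Suc i"] \<beta>
    by (auto simp: state_clique_def inf_traces_def clique_trace_eq_trace_of prefix_word_def act_append)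
  ultimately have "stable_state_clique I act (\<beta>, \<omega> i)"
    unfolding stable_state_clique_def by blast
  then show ?thesis
    using \<beta> by (simp add: state_at_eq)
qed

end

section \<open>First occurrences of a letter that avoid another one\<close>

context independence
begin

text \<open>A choice of one representative in each trace. Sums over traces become sums over the countable
  set of canonical words.\<close>

definition canon :: "'a list \<Rightarrow> 'a list" where
  "canon w = (SOME v. v \<in> trace_of I w)"

lemma canon_cong: "(w, canon w) \<in> trace_cong I"
proof -
  have "w \<in> trace_of I w"
    by (simp add: trace_of_def trace_cong.refl)
  then have "canon w \<in> trace_of I w"
    unfolding canon_def by (rule someI)
  then show ?thesis
    by (simp add: trace_of_def)
qed

lemma canon_eq: "(v, w) \<in> trace_cong I \<Longrightarrow> canon v = canon w"
  unfolding canon_def trace_of_eq_iff[symmetric] by simp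

text \<open>Canonical representatives of the traces that are minimal among those with \<open>k\<close> times the letter \<open>a\<close>,
  and that contain no \<open>b\<close>. For \<open>k > 0\<close>, minimality says that the \<open>k\<close>-th \<open>a\<close> is the only maximal
  occurrence.\<close>

definition hitting :: "'a \<Rightarrow> 'a \<Rightarrow> nat \<Rightarrow> 'a list set" where
  "hitting a b k = {w. canon w = w \<and> count_list w a = k \<and> b \<notin> set w \<and>
     (\<forall>z. trace_le z w \<longrightarrow> count_list z a = k \<longrightarrow> trace_le w z)}"

text \<open>The meet of two such prefixes again contains \<open>k\<close> times the letter \<open>a\<close>, so both are equal to it by
  minimality.\<close>

lemma hitting_unique:
  assumes "x \<in> hitting a b k" "y \<in> hitting a b k" "trace_le x v" "trace_le y v"
  shows "x = y"
proof -
  obtain m where m: "trace_le m x" "trace_le m y"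
      "\<And>c. count_list m c = min (count_list x c) (count_list y c)"
    using trace_le_meet assms(3,4) by blast
  have "count_list m a = k"
    using m(3)[of a] assms(1,2) by (simp add: hitting_def)
  then have "trace_le x m" "trace_le y m"
    using m(1,2) assms(1,2) by (auto simp: hitting_def)
  then have "(x, y) \<in> trace_cong I"
    using m trace_le_antisym trace_le_trans by meson
  then show ?thesis
    using canon_eq assms(1,2) by (metis (mono_tags, lifting) hitting_def mem_Collect_eq)
qed

lemma count_list_prefix_exists:
  "k \<le> count_list z a \<Longrightarrow> \<exists>p. prefix p z \<and> count_list p a = k"
proof (induction z rule: rev_induct)
  case Nil
  then show ?case by simp
next
  case (snoc c z)
  show ?case
  proof (cases "k \<le> count_list z a")
    case True
    then show ?thesis
      using snoc.IH prefix_prefix by blast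
  next
    case False
    then have "count_list (z @ [c]) a = k"
      using snoc.prems by (auto split: if_splits)
    then show ?thesis by blast
  qed
qed

lemma count_list_cong: "(u, v) \<in> trace_cong I \<Longrightarrow> count_list u a = count_list v a"
  unfolding count_list_pair_proj by (rule arg_cong[OF pair_proj_trace_cong]) auto

lemma hitting_exists:
  assumes "k \<le> count_list z a" "b \<notin> set z"
  shows "\<exists>x\<in>hitting a b k. trace_le x z"
proof -
  let ?P = "\<lambda>p. trace_le p z \<and> count_list p a = k"
  obtain p where "?P p"
    using count_list_prefix_exists[OF assms(1)] trace_le_append by (metis prefix_def)
  then obtain m where m: "?P m" "\<And>p. ?P p \<Longrightarrow> length m \<le> length p"
    using ex_has_least_nat[of ?P p length] by blast
  have le_m: "trace_le (canon m) w \<longleftrightarrow> trace_le m w" "trace_le w (canon m) \<longleftrightarrow> trace_le w m" for w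
    using canon_cong trace_le_cong_left trace_le_cong_right by blast+
  have "trace_le m w" if w: "trace_le w m" "count_list w a = k" for w
  proof -
    have "?P w"
      using w m(1) trace_le_trans by blast
    then have "length m \<le> length w"
      by (rule m(2))
    moreover obtain v where v: "(w @ v, m) \<in> trace_cong I"
      using w(1) trace_le_imp_trace_cong by blast
    ultimately have "length v = 0"
      using length_trace_cong[OF v] by (simp only: length_append)
    then have "v = []"
      by simp
    then show ?thesis
      using v trace_cong_imp_trace_le trace_cong.sym by fastforce
  qed
  moreover have "canon (canon m) = canon m"
    by (rule canon_eq[OF trace_cong.sym[OF canon_cong]])
  moreover have "count_list (canon m) a = k"
    using count_list_cong[OF canon_cong] m(1) by simp
  moreover have "b \<notin> set (canon m)"
    using m(1) le_m(1) trace_le_set assms(2) by blast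
  ultimately have "canon m \<in> hitting a b k"
    unfolding hitting_def by (simp add: le_m)
  then show ?thesis
    using m(1) le_m(1) by blast
qed

section \<open>Cylinders\<close>

definition cylinder :: "'a list \<Rightarrow> (nat \<Rightarrow> 'a set) set" where
  "cylinder w = up_set I (trace_of I w)"

lemma cylinder_iff: "\<omega> \<in> cylinder w \<longleftrightarrow> \<omega> \<in> inf_traces I \<and> (\<exists>n. trace_le w (prefix_word \<omega> n))"
  by (simp add: cylinder_def up_set_def trace_below_iff)

lemma cylinder_antimono: "trace_le u v \<Longrightarrow> cylinder v \<subseteq> cylinder u"
  unfolding subset_iff cylinder_iff using trace_le_trans by blast

lemma common_prefix:
  assumes "\<omega> \<in> cylinder u" "\<omega> \<in> cylinder v"
  obtains n where "trace_le u (prefix_word \<omega> n)" "trace_le v (prefix_word \<omega> n)"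
proof -
  obtain m n where "trace_le u (prefix_word \<omega> m)" "trace_le v (prefix_word \<omega> n)"
    using assms by (auto simp: cylinder_iff)
  then have "trace_le u (prefix_word \<omega> (max m n))" "trace_le v (prefix_word \<omega> (max m n))"
    by (blast intro: trace_le_trans prefix_word_mono max.cobounded1 max.cobounded2)+
  then show thesis
    using that by blast
qed

lemma cylinders_disjoint: "disjoint_family_on (\<lambda>y. cylinder (x @ y)) (hitting a b k)"
  unfolding disjoint_family_on_def
proof (intro ballI impI, rule ccontr)
  fix y z assume yz: "y \<in> hitting a b k" "z \<in> hitting a b k" "y \<noteq> z"
    and "cylinder (x @ y) \<inter> cylinder (x @ z) \<noteq> {}"
  then obtain \<omega> n where \<omega>: "trace_le (x @ y) (prefix_word \<omega> n)" "trace_le (x @ z) (prefix_word \<omega> n)"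
    by (meson common_prefix disjoint_iff)
  then have "trace_le x (prefix_word \<omega> n)"
    using trace_le_append trace_le_trans by blast
  then obtain v where "(x @ v, prefix_word \<omega> n) \<in> trace_cong I"
    using trace_le_imp_trace_cong by blast
  then have "trace_le y v" "trace_le z v"
    using \<omega> trace_le_cong_right trace_le_cancel by blast+
  then show False
    using yz hitting_unique by blast
qed

text \<open>By \<open>hitting_exists\<close>, this is the set of infinite traces that have some finite prefix with \<open>k\<close>
  times the letter \<open>a\<close> and no \<open>b\<close>. The union over minimal prefixes is disjoint.\<close>

definition avoiding :: "'a \<Rightarrow> 'a \<Rightarrow> nat \<Rightarrow> (nat \<Rightarrow> 'a set) set" where
  "avoiding a b k = (\<Union>y\<in>hitting a b k. cylinder y)"

text \<open>A prefix with \<open>k + l\<close> times the letter \<open>a\<close> is cut after the \<open>k\<close>-th one; the quotient contains the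
  remaining \<open>l\<close>.\<close>

lemma avoiding_add_subset:
  "avoiding a b (k + l) \<subseteq> (\<Union>x\<in>hitting a b k. \<Union>y\<in>hitting a b l. cylinder (x @ y))"
proof
  fix \<omega> assume "\<omega> \<in> avoiding a b (k + l)"
  then obtain z where z: "z \<in> hitting a b (k + l)" "\<omega> \<in> cylinder z"
    by (auto simp: avoiding_def)
  then have z': "count_list z a = k + l" "b \<notin> set z"
    by (auto simp: hitting_def)
  then obtain x where x: "x \<in> hitting a b k" "trace_le x z"
    using hitting_exists[of k z a b] by auto
  then obtain w where w: "(x @ w, z) \<in> trace_cong I"
    using trace_le_imp_trace_cong by blast
  have "count_list w a = l"
    using count_list_cong[OF w, of a] x(1) z' by (simp add: hitting_def)
  moreover have "b \<notin> set w"
    using trace_le_set[OF trace_cong_imp_trace_le[OF w]] z'(2) by auto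
  ultimately obtain y where y: "y \<in> hitting a b l" "trace_le y w"
    using hitting_exists[of l w a b] by auto
  then have "trace_le (x @ y) z"
    unfolding trace_le_cong_right[OF w, symmetric] by simp
  then show "\<omega> \<in> (\<Union>x\<in>hitting a b k. \<Union>y\<in>hitting a b l. cylinder (x @ y))"
    using x y z cylinder_antimono by blast
qed

text \<open>The projections of two prefixes of one trace to the dependent pair \<open>{a, b}\<close> are comparable. On the
  one side there is a power of \<open>a\<close> with exponent \<open>k\<close>, on the other side a word that ends with \<open>b\<close> and
  contains fewer than \<open>k\<close> times the letter \<open>a\<close>; neither is a prefix of the other.\<close>

lemma avoiding_cylinder_disjoint:
  assumes "(a, b) \<notin> I" "a \<noteq> b" "count_list u a < k"
  shows "avoiding a b k \<inter> cylinder (u @ [b]) = {}"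
proof (rule ccontr)
  assume "avoiding a b k \<inter> cylinder (u @ [b]) \<noteq> {}"
  then obtain \<omega> y where "y \<in> hitting a b k" "\<omega> \<in> cylinder y" "\<omega> \<in> cylinder (u @ [b])"
    by (auto simp: avoiding_def)
  then obtain n where le: "trace_le y (prefix_word \<omega> n)" "trace_le (u @ [b]) (prefix_word \<omega> n)"
    and y: "count_list y a = k" "b \<notin> set y"
    by (metis (mono_tags, lifting) common_prefix hitting_def mem_Collect_eq)
  have "prefix (pair_proj a b y) (pair_proj a b (u @ [b]))
      \<or> prefix (pair_proj a b (u @ [b])) (pair_proj a b y)"
    using le assms(1) prefix_same_cases unfolding trace_le_def by blast
  then show False
  proof
    assume "prefix (pair_proj a b y) (pair_proj a b (u @ [b]))"
    then have "count_list (pair_proj a b y) a \<le> count_list (pair_proj a b (u @ [b])) a"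
      by (metis count_list_append le_add1 prefix_def)
    moreover have "count_list (pair_proj a b w) a = count_list w a" for w
      by (induction w) auto
    ultimately show False
      using y(1) assms(2,3) by simp
  next
    assume "prefix (pair_proj a b (u @ [b])) (pair_proj a b y)"
    then have "set (pair_proj a b (u @ [b])) \<subseteq> set (pair_proj a b y)"
      by (rule set_mono_prefix)
    then show False
      using y(2) by auto
  qed
qed

lemma count_list_segment_unbounded:
  assumes "infinite {i. (a :: 'a) \<in> \<omega> i}"
  shows "\<exists>M\<ge>m. n \<le> count_list (word_of (map \<omega> [m..<M])) a"
proof (induction n)
  case 0
  show ?case by auto
next
  case (Suc n)
  then obtain M where M: "M \<ge> m" "n \<le> count_list (word_of (map \<omega> [m..<M])) a"
    by blast
  obtain j where j: "j \<ge> M" "a \<in> \<omega> j"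
    using assms by (auto simp: infinite_nat_iff_unbounded_le)
  have "[m..<Suc j] = [m..<M] @ [M..<j] @ [j]"
    using M(1) j(1) upt_add_eq_append[of m M "j - M"] by simp
  then have "count_list (word_of (map \<omega> [m..<Suc j])) a
      = count_list (word_of (map \<omega> [m..<M])) a + count_list (word_of (map \<omega> [M..<j])) a
        + count_list (clique_word (\<omega> j)) a"
    by simp
  moreover have "count_list (clique_word (\<omega> j)) a \<noteq> 0"
    using j(2) by (simp add: count_list_0_iff clique_word)
  ultimately show ?case
    using M j by (intro exI[of _ "Suc j"]) simp
qed

text \<open>If \<open>b\<close> does not occur from clique \<open>m\<close> on, but \<open>a\<close> recurs, then behind the first \<open>m\<close> cliques there
  are segments with arbitrarily many \<open>a\<close> and without \<open>b\<close>. The event to be escaped is indexed by the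
  finite prefix \<open>x\<close> that contains all \<open>b\<close>, hence by a countable set.\<close>

lemma recurrence_spreads:
  assumes "\<omega> \<in> inf_traces I" "infinite {i. a \<in> \<omega> i}"
    and escape: "\<And>x. \<omega> \<notin> (\<Inter>n. \<Union>y\<in>hitting a b n. cylinder (x @ y))"
  shows "infinite {i. b \<in> \<omega> i}"
proof
  assume "finite {i. b \<in> \<omega> i}"
  then obtain m where m: "\<And>i. i \<ge> m \<Longrightarrow> b \<notin> \<omega> i"
    unfolding finite_nat_set_iff_bounded by (metis mem_Collect_eq not_less)
  have "\<omega> \<in> (\<Union>y\<in>hitting a b n. cylinder (prefix_word \<omega> m @ y))" for n
  proof -
    obtain M where M: "M \<ge> m" "n \<le> count_list (word_of (map \<omega> [m..<M])) a"
      using count_list_segment_unbounded[OF assms(2)] by blast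
    moreover have "b \<notin> set (word_of (map \<omega> [m..<M]))"
      using m by (auto simp: set_word_of)
    ultimately obtain y where y: "y \<in> hitting a b n" "trace_le y (word_of (map \<omega> [m..<M]))"
      using hitting_exists by blast
    then have "trace_le (prefix_word \<omega> m @ y) (prefix_word \<omega> M)"
      using M(1) by (simp add: prefix_word_split)
    then show ?thesis
      using y(1) assms(1) by (auto simp: cylinder_iff)
  qed
  then show False
    using escape[of "prefix_word \<omega> m"] by blast
qed

text \<open>If \<open>w\<close> is below the product of the first \<open>n\<close> cliques of \<open>\<omega>\<close>, then this also holds for every
  sequence that agrees with \<open>\<omega>\<close> in these \<open>n\<close> coordinates.\<close>

lemma open_cylinder: "openin (inf_trace_topology I) (cylinder w)"
proof -
  define S where "S = {\<omega>. \<exists>n. trace_le w (prefix_word \<omega> n)}"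
  have "openin (product_topology (\<lambda>_. discrete_topology UNIV) UNIV) S"
    unfolding openin_product_topology_alt
  proof
    fix \<omega> assume "\<omega> \<in> S"
    then obtain n where n: "trace_le w (prefix_word \<omega> n)"
      by (auto simp: S_def)
    define U where "U = (\<lambda>i. if i < n then {\<omega> i} else UNIV)"
    have "\<omega>' \<in> S" if "\<omega>' \<in> Pi\<^sub>E UNIV U" for \<omega>'
    proof -
      have "\<omega>' i = \<omega> i" if "i < n" for i
        using PiE_mem[OF \<open>\<omega>' \<in> Pi\<^sub>E UNIV U\<close>, of i] that by (simp add: U_def)
      then have "prefix_word \<omega>' n = prefix_word \<omega> n"
        unfolding prefix_word_def by (intro arg_cong[of _ _ word_of] map_cong) auto
      then show ?thesis
        using n unfolding S_def mem_Collect_eq by metis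
    qed
    moreover have "finite {i \<in> UNIV. U i \<noteq> topspace (discrete_topology UNIV)}"
      by (rule finite_subset[of _ "{..<n}"]) (auto simp: U_def)
    moreover have "\<omega> \<in> Pi\<^sub>E UNIV U"
      by (auto simp: U_def)
    ultimately show "\<exists>U. finite {i \<in> UNIV. U i \<noteq> topspace (discrete_topology UNIV)} \<and>
        (\<forall>i\<in>UNIV. openin (discrete_topology UNIV) (U i)) \<and> \<omega> \<in> Pi\<^sub>E UNIV U \<and> Pi\<^sub>E UNIV U \<subseteq> S"
      by (intro exI[of _ U]) auto
  qed
  moreover have "cylinder w = S \<inter> inf_traces I"
    by (auto simp: cylinder_iff S_def)
  ultimately show ?thesis
    unfolding inf_trace_topology_def openin_subtopology by blast
qed

lemma inf_trace_borel_basic: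
  "space (inf_trace_borel I) = inf_traces I"
  "sets (inf_trace_borel I) = sigma_sets (inf_traces I) {U. openin (inf_trace_topology I) U}"
proof -
  have "{U. openin (inf_trace_topology I) U} \<subseteq> Pow (inf_traces I)"
    using openin_subset by (fastforce simp: inf_trace_topology_def)
  then show "space (inf_trace_borel I) = inf_traces I"
    "sets (inf_trace_borel I) = sigma_sets (inf_traces I) {U. openin (inf_trace_topology I) U}"
    unfolding inf_trace_borel_def by auto
qed

lemma cylinder_in_sets: "cylinder w \<in> sets (inf_trace_borel I)"
  unfolding inf_trace_borel_basic(2) using open_cylinder by (auto intro: sigma_sets.Basic)

end

section \<open>Almost sure recurrence under a Markov measure\<close>

locale markov_system = irreducible_concurrent_system I act
  for I :: "('a::finite \<times> 'a) set"
    and act :: "'s::finite option \<Rightarrow> 'a list set \<Rightarrow> 's option" +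
  fixes \<nu> :: "'s \<Rightarrow> (nat \<Rightarrow> 'a set) measure"
  assumes markov: "markov_measure I act \<nu>"
begin

lemma sets_nu: "sets (\<nu> \<alpha>) = sets (inf_trace_borel I)"
  using markov by (simp add: markov_measure_def)

lemma space_nu: "space (\<nu> \<alpha>) = inf_traces I"
  using sets_eq_imp_space_eq[OF sets_nu] inf_trace_borel_basic(1) by simp

lemma prob_space_nu: "prob_space (\<nu> \<alpha>)"
  using markov by (simp add: markov_measure_def)

lemma cylinder_sets [measurable]: "cylinder w \<in> sets (\<nu> \<alpha>)"
  using cylinder_in_sets by (simp add: sets_nu)

lemma UN_cylinder_sets: "(\<Union>y\<in>H. cylinder (x @ y)) \<in> sets (\<nu> \<alpha>)"
  by (intro sets.countable_UN') auto

lemma avoiding_sets [measurable]: "avoiding a b k \<in> sets (\<nu> \<alpha>)"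
  using UN_cylinder_sets[of "[]"] by (simp add: avoiding_def)

lemma emeasure_cylinder_append:
  "emeasure (\<nu> \<alpha>) (cylinder (u @ v)) =
    (case act (Some \<alpha>) (trace_of I u) of None \<Rightarrow> 0
     | Some \<beta> \<Rightarrow> emeasure (\<nu> \<alpha>) (cylinder u) * emeasure (\<nu> \<beta>) (cylinder v))"
proof -
  interpret prob_space "\<nu> \<gamma>" for \<gamma> by (rule prob_space_nu)
  have "measure (\<nu> \<alpha>) (cylinder (u @ v)) =
    (case act (Some \<alpha>) (trace_of I u) of None \<Rightarrow> 0
     | Some \<beta> \<Rightarrow> measure (\<nu> \<alpha>) (cylinder u) * measure (\<nu> \<beta>) (cylinder v))"
    using markov trace_of_in_carrier unfolding markov_measure_def cylinder_def mult_trace_monoid[symmetric]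
    by blast
  then show ?thesis
    by (auto simp: emeasure_eq_measure ennreal_mult split: option.splits)
qed

lemma measure_cylinder_pos:
  "trace_of I w \<in> enabled I act \<alpha> \<Longrightarrow> measure (\<nu> \<alpha>) (cylinder w) > 0"
  using markov trace_of_in_carrier unfolding markov_measure_def cylinder_def by blast

text \<open>The Markov property is given for cylinders only; it carries over to \<open>avoiding a b k\<close>, as this is a
  disjoint union of cylinders and remains one after left multiplication by \<open>x\<close>.\<close>

lemma emeasure_shifted_avoiding:
  "emeasure (\<nu> \<alpha>) (\<Union>y\<in>hitting a b k. cylinder (x @ y)) =
    (case act (Some \<alpha>) (trace_of I x) of None \<Rightarrow> 0
     | Some \<beta> \<Rightarrow> emeasure (\<nu> \<alpha>) (cylinder x) * emeasure (\<nu> \<beta>) (avoiding a b k))"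
proof -
  have split: "emeasure (\<nu> \<gamma>) (\<Union>y\<in>hitting a b k. cylinder (z @ y)) =
      (\<integral>\<^sup>+ y. emeasure (\<nu> \<gamma>) (cylinder (z @ y)) \<partial>count_space (hitting a b k))" for \<gamma> z
    by (rule emeasure_UN_countable) (auto simp: cylinders_disjoint)
  note avoiding_split = split[of _ "[]", unfolded append_Nil avoiding_def[symmetric]]
  show ?thesis
  proof (cases "act (Some \<alpha>) (trace_of I x)")
    case None
    then show ?thesis
      unfolding split emeasure_cylinder_append by simp
  next
    case (Some \<beta>)
    then show ?thesis
      by (simp add: split avoiding_split emeasure_cylinder_append nn_integral_cmult)
  qed
qed

text \<open>Submultiplicativity: condition on the minimal prefix \<open>x\<close> with \<open>k\<close> times the letter \<open>a\<close>. The state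
  reached by \<open>x\<close> is arbitrary, so the bound \<open>r\<close> has to be uniform in the state.\<close>

lemma emeasure_avoiding_add_le:
  assumes "\<And>\<beta>. emeasure (\<nu> \<beta>) (avoiding a b l) \<le> r"
  shows "emeasure (\<nu> \<alpha>) (avoiding a b (k + l)) \<le> emeasure (\<nu> \<alpha>) (avoiding a b k) * r"
proof -
  let ?B = "\<lambda>x. \<Union>y\<in>hitting a b l. cylinder (x @ y)"
  have B_subset: "?B x \<subseteq> cylinder x" for x
    using cylinder_antimono[OF trace_le_append] by blast
  have disj: "disjoint_family_on ?B (hitting a b k)"
    unfolding disjoint_family_on_def
  proof (intro ballI impI)
    fix x z assume "x \<in> hitting a b k" "z \<in> hitting a b k" "x \<noteq> z"
    then have "cylinder x \<inter> cylinder z = {}"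
      using disjoint_family_onD[OF cylinders_disjoint[of "[]" a b k]] by simp
    then show "?B x \<inter> ?B z = {}"
      using B_subset[of x] B_subset[of z] by blast
  qed
  have B_le: "emeasure (\<nu> \<alpha>) (?B x) \<le> emeasure (\<nu> \<alpha>) (cylinder x) * r" for x
    unfolding emeasure_shifted_avoiding using assms by (auto split: option.split intro: mult_left_mono)
  have "emeasure (\<nu> \<alpha>) (avoiding a b (k + l)) \<le> emeasure (\<nu> \<alpha>) (\<Union>x\<in>hitting a b k. ?B x)"
    by (rule emeasure_mono[OF avoiding_add_subset], rule sets.countable_UN')
      (simp_all add: UN_cylinder_sets image_subset_iff)
  also have "\<dots> = (\<integral>\<^sup>+ x. emeasure (\<nu> \<alpha>) (?B x) \<partial>count_space (hitting a b k))"
    by (rule emeasure_UN_countable) (auto simp: disj UN_cylinder_sets)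
  also have "\<dots> \<le> (\<integral>\<^sup>+ x. emeasure (\<nu> \<alpha>) (cylinder x) * r \<partial>count_space (hitting a b k))"
    by (intro nn_integral_mono B_le)
  also have "\<dots> = (\<integral>\<^sup>+ x. emeasure (\<nu> \<alpha>) (cylinder x) \<partial>count_space (hitting a b k)) * r"
    by (rule nn_integral_multc) auto
  also have "(\<integral>\<^sup>+ x. emeasure (\<nu> \<alpha>) (cylinder x) \<partial>count_space (hitting a b k))
      = emeasure (\<nu> \<alpha>) (avoiding a b k)"
    unfolding avoiding_def
    by (rule emeasure_UN_countable[symmetric]) (use cylinders_disjoint[of "[]" a b k] in auto)
  finally show ?thesis .
qed

text \<open>From every state \<open>\<beta>\<close> the letter \<open>b\<close> can be reached along some \<open>u \<beta>\<close>, and this has positive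
  probability. Finiteness of the state space makes both the number of \<open>a\<close> in \<open>u \<beta>\<close> and the bound on the
  probability uniform.\<close>

lemma avoiding_uniformly_small:
  assumes "(a, b) \<notin> I" "a \<noteq> b"
  obtains K r where "0 \<le> r" "r < 1" "\<And>\<beta>. emeasure (\<nu> \<beta>) (avoiding a b K) \<le> ennreal r"
proof -
  interpret prob_space "\<nu> \<gamma>" for \<gamma> by (rule prob_space_nu)
  have "\<exists>u. trace_of I (u @ [b]) \<in> enabled I act \<beta>" for \<beta>
    using letters_accessible[of b \<beta>] by (auto simp: carrier_trace_monoid mult_trace_monoid)
  then obtain u where u: "\<And>\<beta>. trace_of I (u \<beta> @ [b]) \<in> enabled I act \<beta>"
    by metis
  define K where "K = Suc (\<Sum>\<beta>\<in>UNIV. count_list (u \<beta>) a)"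
  have K: "count_list (u \<beta>) a < K" for \<beta>
    unfolding K_def less_Suc_eq_le by (rule member_le_sum) auto
  have lt1: "measure (\<nu> \<beta>) (avoiding a b K) < 1" for \<beta>
  proof -
    have "measure (\<nu> \<beta>) (avoiding a b K) + measure (\<nu> \<beta>) (cylinder (u \<beta> @ [b]))
        = measure (\<nu> \<beta>) (avoiding a b K \<union> cylinder (u \<beta> @ [b]))"
      by (rule finite_measure_Union[symmetric]) (use avoiding_cylinder_disjoint[OF assms K] in auto)
    also have "\<dots> \<le> 1"
      by (rule prob_le_1)
    finally show ?thesis
      using measure_cylinder_pos[OF u, of \<beta>] by linarith
  qed
  define r where "r = Max (range (\<lambda>\<beta>. measure (\<nu> \<beta>) (avoiding a b K)))"
  have le: "measure (\<nu> \<beta>) (avoiding a b K) \<le> r" for \<beta>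
    unfolding r_def by (rule Max_ge) auto
  show thesis
  proof (rule that)
    show "0 \<le> r"
      using le measure_nonneg order_trans by blast
    show "r < 1"
      unfolding r_def by (subst Max_less_iff) (auto simp: lt1)
    show "emeasure (\<nu> \<beta>) (avoiding a b K) \<le> ennreal r" for \<beta>
      using le by (simp add: emeasure_eq_measure ennreal_leI)
  qed
qed

text \<open>By submultiplicativity, the probability of \<open>avoiding a b (n * K)\<close> is at most the \<open>n\<close>-th power of a
  number less than \<open>1\<close>, uniformly in the state. So this also bounds the probability after the shift by
  \<open>x\<close>, which starts from the state reached by \<open>x\<close>.\<close>

lemma shifted_avoiding_null:
  assumes "(a, b) \<notin> I" "a \<noteq> b"
  shows "(\<Inter>n. \<Union>y\<in>hitting a b n. cylinder (x @ y)) \<in> null_sets (\<nu> \<alpha>)"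
proof -
  let ?B = "\<lambda>n. \<Union>y\<in>hitting a b n. cylinder (x @ y)"
  interpret prob_space "\<nu> \<gamma>" for \<gamma> by (rule prob_space_nu)
  obtain r K where r: "0 \<le> r" "r < 1" "\<And>\<beta>. emeasure (\<nu> \<beta>) (avoiding a b K) \<le> ennreal r"
    using avoiding_uniformly_small[OF assms] by metis
  have avoiding_le: "emeasure (\<nu> \<beta>) (avoiding a b (n * K)) \<le> ennreal (r ^ n)" for \<beta> n
  proof (induction n)
    case 0
    show ?case by (simp add: emeasure_le_1)
  next
    case (Suc n)
    have "emeasure (\<nu> \<beta>) (avoiding a b (n * K + K))
        \<le> emeasure (\<nu> \<beta>) (avoiding a b (n * K)) * ennreal r"
      by (rule emeasure_avoiding_add_le[OF r(3)])
    also have "\<dots> \<le> ennreal (r ^ n) * ennreal r"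
      by (intro mult_right_mono Suc.IH) simp
    also have "\<dots> = ennreal (r ^ Suc n)"
      using r(1) by (simp add: ennreal_mult[symmetric] mult.commute)
    finally show ?case
      by (simp add: add.commute)
  qed
  have sets: "(\<Inter>n. ?B n) \<in> sets (\<nu> \<alpha>)"
    by (rule sets.countable_INT) (auto simp: UN_cylinder_sets)
  have "emeasure (\<nu> \<alpha>) (\<Inter>n. ?B n) \<le> ennreal (r ^ n)" for n
  proof -
    have "emeasure (\<nu> \<alpha>) (\<Inter>n. ?B n) \<le> emeasure (\<nu> \<alpha>) (?B (n * K))"
      by (rule emeasure_mono[OF _ UN_cylinder_sets]) blast
    also have "\<dots> \<le> ennreal (r ^ n)"
    proof (cases "act (Some \<alpha>) (trace_of I x)")
      case (Some \<beta>)
      have "emeasure (\<nu> \<alpha>) (cylinder x) * emeasure (\<nu> \<beta>) (avoiding a b (n * K)) \<le> 1 * ennreal (r ^ n)"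
        by (intro mult_mono avoiding_le emeasure_le_1) auto
      then show ?thesis
        by (simp add: emeasure_shifted_avoiding Some)
    qed (simp add: emeasure_shifted_avoiding)
    finally show ?thesis .
  qed
  moreover have "(\<lambda>n. ennreal (r ^ n)) \<longlonglongrightarrow> ennreal 0"
    using r by (intro tendsto_ennrealI LIMSEQ_power_zero) simp
  ultimately have "emeasure (\<nu> \<alpha>) (\<Inter>n. ?B n) \<le> ennreal 0"
    by (intro LIMSEQ_le_const) auto
  then show ?thesis
    using sets by (auto simp: null_sets_def)
qed

text \<open>Some letter recurs by the pigeonhole principle, and recurrence spreads along the edges of the
  dependence graph, which is connected.\<close>

lemma AE_all_letters_recur: "AE \<omega> in \<nu> \<alpha>. \<forall>a. infinite {i. a \<in> \<omega> i}"
proof -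
  let ?N = "\<lambda>a b x. \<Inter>n. \<Union>y\<in>hitting a b n. cylinder (x @ y)"
  have "AE \<omega> in \<nu> \<alpha>. \<forall>x. \<omega> \<notin> ?N a b x" if "(a, b) \<notin> I" "a \<noteq> b" for a b
    unfolding AE_all_countable by (intro allI AE_not_in shifted_avoiding_null that)
  then have "AE \<omega> in \<nu> \<alpha>. (a, b) \<notin> I \<and> a \<noteq> b \<longrightarrow> (\<forall>x. \<omega> \<notin> ?N a b x)" for a b
    by (intro AE_impI) blast
  then have "AE \<omega> in \<nu> \<alpha>. \<forall>a b. (a, b) \<notin> I \<and> a \<noteq> b \<longrightarrow> (\<forall>x. \<omega> \<notin> ?N a b x)"
    unfolding AE_all_countable by blast
  moreover have "AE \<omega> in \<nu> \<alpha>. \<omega> \<in> inf_traces I"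
    using AE_space[of "\<nu> \<alpha>"] by (simp add: space_nu)
  ultimately show ?thesis
  proof eventually_elim
    case (elim \<omega>)
    have spread: "infinite {i. b \<in> \<omega> i}" if "(a, b) \<notin> I" "infinite {i. a \<in> \<omega> i}" for a b
    proof (cases "a = b")
      case False
      then have "\<omega> \<notin> ?N a b x" for x
        using elim(1) that(1) by metis
      then show ?thesis
        by (rule recurrence_spreads[OF elim(2) that(2)])
    qed (use that(2) in simp)
    have "\<exists>a. infinite {i. a \<in> \<omega> i}"
    proof (rule ccontr)
      assume "\<nexists>a. infinite {i. a \<in> \<omega> i}"
      then have "finite (\<Union>a. {i. a \<in> \<omega> i})"
        by (intro finite_UN_I) auto
      moreover have "(\<Union>a. {i. a \<in> \<omega> i}) = UNIV"
        using elim(2) by (auto simp: inf_traces_def)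
      ultimately show False by simp
    qed
    then obtain a where a: "infinite {i. a \<in> \<omega> i}" ..
    show ?case
    proof
      fix b
      show "infinite {i. b \<in> \<omega> i}"
        using irreducible_monoid[of a b]
      proof (induction rule: rtrancl_induct)
        case base
        show ?case by (fact a)
      next
        case (step c d)
        then show ?case
          using spread[of c d] by simp
      qed
    qed
  qed
qed

lemma AE_inf_enabled: "AE \<omega> in \<nu> \<alpha>. \<omega> \<in> inf_enabled I act \<alpha>"
proof -
  interpret prob_space "\<nu> \<alpha>" by (rule prob_space_nu)
  have one: "measure (\<nu> \<alpha>) (inf_enabled I act \<alpha>) = 1"
    using markov by (simp add: markov_measure_def)
  then have "inf_enabled I act \<alpha> \<in> sets (\<nu> \<alpha>)"
    using measure_notin_sets by fastforce
  then show ?thesis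
    using one by (simp add: prob_eq_1)
qed

end

theorem corollary4p16:
  fixes I :: "('a::finite \<times> 'a) set"
    and act :: "'s::finite option \<Rightarrow> 'a list set \<Rightarrow> 's option"
    and \<nu> :: "'s \<Rightarrow> (nat \<Rightarrow> 'a set) measure"
  assumes "irreducible_concurrent_system I act"
    and "markov_measure I act \<nu>"
  shows "\<forall>\<alpha>. AE \<omega> in \<nu> \<alpha>. \<forall>i. \<exists>\<beta>.
    state_at I act \<alpha> \<omega> i = Some \<beta> \<and> stable_state_clique I act (\<beta>, \<omega> i)"
proof
  fix \<alpha>
  interpret markov_system I act \<nu>
    using assms by (simp add: markov_system_def markov_system_axioms_def)
  from AE_inf_enabled[of \<alpha>] AE_all_letters_recur[of \<alpha>]
  show "AE \<omega> in \<nu> \<alpha>. \<forall>i. \<exists>\<beta>.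
      state_at I act \<alpha> \<omega> i = Some \<beta> \<and> stable_state_clique I act (\<beta>, \<omega> i)"
    by eventually_elim (blast intro: stable_if_all_letters_recur)
qed

end
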